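(* There exist infinitely many periodic symbolic orbits: the set of periodic words $\omega\in\{a,b\}^{\mathbb{N}}$ that are the symbolic orbit of some breakout orbit is infinite.
   Context: Breakout system. The domain is $\mathbb{R}^2$ and initially all the unit bricks $[x,x+1]\times[y,y+1]$, $(x,y)\in\mathbb{Z}^2\setminus\{(-1,0)\}$, are present. A ball is launched from $(0,y_0)$, for some $0<y_0<1$, in a direction with two positive coordinates and slope $S\in(0,1)$. It moves in a straight line; each time it hits an edge of a brick still present, it is reflected as in a billiard and that brick is destroyed (so at time $0$ the brick $[0,1]\times[0,1]$, brick number $0$, is hit on its left vertical edge and destroyed, and the ball leaves towards decreasing abscissas). Orbits are always assumed not to meet any point of $\mathbb{Z}^2$. The symbolic orbit of a breakout orbit is the right-infinite word $\omega=(\omega_n)_{n\in\mathbb{N}}\in\{a,b\}^{\mathbb{N}}$ such that $\omega_n=a$ if the $n$th destroyed brick (numbered from $0$ in order of destruction) was broken by hitting a horizontal edge, and $\omega_n=b$ otherwise. *)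

theory Defs
  imports "HOL-Analysis.Analysis"
begin

text \<open>The pair (i, j) stands for the brick with lower left corner (i, j), i.e. the unit square
  {i..i+1} \<times> {j..j+1}.\<close>

type_synonym brick = "int \<times> int"

type_synonym point = "real \<times> real"

definition horizontal_edges :: "brick \<Rightarrow> point set" where
  "horizontal_edges e =
     {real_of_int (fst e) .. real_of_int (fst e) + 1} \<times> {real_of_int (snd e), real_of_int (snd e) + 1}"

definition vertical_edges :: "brick \<Rightarrow> point set" where
  "vertical_edges e =
     {real_of_int (fst e), real_of_int (fst e) + 1} \<times> {real_of_int (snd e) .. real_of_int (snd e) + 1}"

definition edges :: "brick \<Rightarrow> point set" where
  "edges e = horizontal_edges e \<union> vertical_edges e"

text \<open>The sequence c lists the destroyed bricks in order of destruction; \<open>present c n\<close> is the set of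
  bricks remaining after the destruction of bricks number 0, ..., n - 1.\<close>

definition present :: "(nat \<Rightarrow> brick) \<Rightarrow> nat \<Rightarrow> brick set" where
  "present c n = UNIV - {(-1, 0)} - c ` {..<n}"

text \<open>Horizontal and vertical edges meet only in lattice points, which orbits avoid.\<close>

definition reflect :: "brick \<Rightarrow> point \<Rightarrow> point \<Rightarrow> point" where
  "reflect e q u = (if q \<in> horizontal_edges e then (fst u, - snd u) else (- fst u, snd u))"

text \<open>A ball starting at q with velocity u hits brick e at q', and no remaining brick (of the set P)
  earlier, nor any lattice point on the way (end points included). The starting point is excluded
  from the search for the next hit because the ball starts on an edge of the brick it has just
  destroyed. Before the hit the ball is outside the remaining bricks, so of the two bricks sharing
  the edge that is hit, only one can be in P: e is determined by P, q and u.\<close>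

definition flight :: "brick set \<Rightarrow> point \<Rightarrow> point \<Rightarrow> brick \<Rightarrow> point \<Rightarrow> bool" where
  "flight P q u e q' \<longleftrightarrow>
     (\<exists>t>0. q' = q + t *\<^sub>R u \<and> e \<in> P \<and> q' \<in> edges e \<and>
        (\<forall>s\<in>{0<..<t}. \<forall>d\<in>P. q + s *\<^sub>R u \<notin> edges d) \<and>
        (\<forall>s\<in>{0..t}. q + s *\<^sub>R u \<notin> \<int> \<times> \<int>))"

text \<open>The nth hit takes place at \<open>p n\<close>, with incoming velocity \<open>v n\<close>, and destroys brick \<open>c n\<close>. The
  speed of the ball is irrelevant, so the launch velocity is normalized to (1, S).\<close>

definition breakout_orbit ::
  "real \<Rightarrow> real \<Rightarrow> (nat \<Rightarrow> brick) \<Rightarrow> (nat \<Rightarrow> point) \<Rightarrow> (nat \<Rightarrow> point) \<Rightarrow> bool" where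
  "breakout_orbit y0 S c p v \<longleftrightarrow>
     0 < y0 \<and> y0 < 1 \<and> 0 < S \<and> S < 1 \<and>
     c 0 = (0, 0) \<and> p 0 = (0, y0) \<and> v 0 = (1, S) \<and>
     (\<forall>n. v (Suc n) = reflect (c n) (p n) (v n) \<and>
          flight (present c (Suc n)) (p n) (v (Suc n)) (c (Suc n)) (p (Suc n)))"

datatype letter = A | B

definition symbolic_word :: "(nat \<Rightarrow> brick) \<Rightarrow> (nat \<Rightarrow> point) \<Rightarrow> nat \<Rightarrow> letter" where
  "symbolic_word c p n = (if p n \<in> horizontal_edges (c n) then A else B)"

definition symbolic_orbit :: "(nat \<Rightarrow> letter) \<Rightarrow> bool" where
  "symbolic_orbit \<omega> \<longleftrightarrow> (\<exists>y0 S c p v. breakout_orbit y0 S c p v \<and> \<omega> = symbolic_word c p)"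

text \<open>Purely, not just eventually, periodic.\<close>

definition periodic_word :: "(nat \<Rightarrow> 'a) \<Rightarrow> bool" where
  "periodic_word \<omega> \<longleftrightarrow> (\<exists>k>0. \<forall>n. \<omega> (n + k) = \<omega> n)"

end

theory Submission
  imports Defs "HOL-Analysis.Kronecker_Approximation_Theorem"
begin

text \<open>The orbits used here build a tower of rows. Take slope \<open>1 / n\<close> and initial height
  \<open>1 / (2 * n)\<close> with \<open>n\<close> large. While the ball stays between two neighbouring horizontal grid
  lines it runs to and fro in a horizontal corridor and destroys one brick at each end in turn, so
  its passes have lengths 1, 2, 3, \<dots>; side hit number \<open>j\<close> occurs after the horizontal distance
  \<open>j * (j + 1) / 2\<close>. Its height is a function of the horizontal distance too: the ball meets the
  ceiling after \<open>n - 1 / 2\<close>, the floor after \<open>2 * n - 1 / 2\<close>, and the ceiling again after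
  \<open>3 * n - 1 / 2\<close>. At the first two meetings it destroys a brick above, respectively below, the row.

  Now let \<open>n = v\<^sup>2 - u\<^sup>2\<close>. In an even pass \<open>2 * k\<close>, directed to the right, the abscissa is the
  distance minus \<open>2 * k\<^sup>2\<close>. So, if the two meetings with the ceiling happen in passes \<open>2 * u\<close> and
  \<open>2 * v\<close>, both have the abscissa \<open>D - 1 / 2\<close> with \<open>D = v\<^sup>2 - 3 * u\<^sup>2\<close>: the ball leaves the row
  through the hole that it made itself, enters the row above, and at distance \<open>3 * n\<close> hits the
  next brick there, at the same relative height as at the start. The brick initially missing in
  front of brick number 0 is this hole. From here on everything repeats, shifted by the vector
  \<open>(D, 1)\<close>, provided that the floor brick due to be hit in the new row is still there: the new
  floor has been broken up where the preceding row was widened, and the hit has to take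
  place beyond the end of that row. Then the word is periodic, and its first \<open>A\<close> has the index
  \<open>2 * u\<close>, so distinct \<open>u\<close> give distinct words (\<open>row_tower_orbit\<close>, \<open>word_periodic\<close>,
  \<open>word_first_A\<close>).

  If the floor is met in pass \<open>2 * w\<close>, the conditions on \<open>(u, v, w)\<close> are inequalities which,
  up to lower order terms, restrict only \<open>v - sqrt 3 * u\<close> and \<open>w - sqrt 2 * u\<close> to certain open
  intervals. The triple \<open>(12, 21, 17)\<close> satisfies them, and adding to it triples \<open>(q, a, b)\<close> for
  which \<open>a - sqrt 3 * q\<close> and \<open>b - sqrt 2 * q\<close> are tiny, which exist by Dirichlet's theorem on
  simultaneous approximation, yields solutions with arbitrarily large \<open>u\<close>
  (\<open>tower_exists\<close>).\<close>

section \<open>Free flight and reflection\<close>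

lemma ne_int_if_between:
  assumes "real_of_int k < x" "x < real_of_int k + 1"
  shows "x \<noteq> real_of_int z"
proof
  assume "x = real_of_int z"
  then have "real_of_int k < real_of_int z" "real_of_int z < real_of_int (k + 1)" using assms by auto
  then show False by (simp only: of_int_less_iff)
qed

lemma ne_int_plus_one_if_between:
  assumes "real_of_int k < x" "x < real_of_int k + 1"
  shows "x \<noteq> real_of_int z + 1"
  using ne_int_if_between[OF assms, of "z + 1"] by simp

text \<open>A point strictly inside row \<open>r\<close> can only be on a vertical edge of a brick of that row, and the
  bricks that have a vertical edge strictly between the abscissas \<open>a\<close> and \<open>b\<close> are among
  those in columns \<open>a, \<dots>, b - 1\<close>.\<close>

lemma not_on_edge_inside_row:
  assumes "real_of_int r < y" "y < real_of_int r + 1" "real_of_int a < x" "x < real_of_int b"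
    and "\<And>k. a \<le> k \<Longrightarrow> k < b \<Longrightarrow> (k, r) \<notin> P" and "d \<in> P"
  shows "(x, y) \<notin> edges d"
proof
  assume "(x, y) \<in> edges d"
  then have y: "real_of_int (snd d) \<le> y" "y \<le> real_of_int (snd d) + 1"
    and xy: "x = real_of_int (fst d) \<or> x = real_of_int (fst d) + 1
      \<or> y = real_of_int (snd d) \<or> y = real_of_int (snd d) + 1"
    by (auto simp: edges_def horizontal_edges_def vertical_edges_def)
  have r: "snd d = r" using y assms(1,2) by linarith
  then have "x = real_of_int (fst d) \<or> x = real_of_int (fst d) + 1" using xy assms(1,2) by auto
  then have "a \<le> fst d" "fst d < b" using assms(3,4) by linarith+
  then show False using assms(5)[of "fst d"] r assms(6) by (metis prod.collapse)
qed

lemma not_on_edge_at_crossing: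
  assumes "real_of_int k < x" "x < real_of_int k + 1" "(k, r - 1) \<notin> P" "(k, r) \<notin> P" "d \<in> P"
  shows "(x, real_of_int r) \<notin> edges d"
proof
  assume e: "(x, real_of_int r) \<in> edges d"
  have "x \<noteq> real_of_int (fst d)" "x \<noteq> real_of_int (fst d) + 1"
    using assms(1,2) ne_int_if_between ne_int_plus_one_if_between by blast+
  then have xd: "real_of_int (fst d) \<le> x" "x \<le> real_of_int (fst d) + 1"
    and yd: "real_of_int r = real_of_int (snd d) \<or> real_of_int r = real_of_int (snd d) + 1"
    using e by (auto simp: edges_def horizontal_edges_def vertical_edges_def)
  have "fst d = k" using xd assms(1,2) by linarith
  moreover have "snd d = r \<or> snd d = r - 1" using yd by linarith
  ultimately show False using assms(3-5) by (metis prod.collapse)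
qed

lemma not_lattice_fst:
  assumes "real_of_int k < x" "x < real_of_int k + 1"
  shows "(x, y) \<notin> \<int> \<times> \<int>"
proof
  assume "(x, y) \<in> \<int> \<times> \<int>"
  then obtain z where "x = real_of_int z" by (auto elim: Ints_cases)
  then show False using ne_int_if_between assms by blast
qed

lemma not_lattice_snd:
  assumes "real_of_int k < y" "y < real_of_int k + 1"
  shows "(x, y) \<notin> \<int> \<times> \<int>"
proof
  assume "(x, y) \<in> \<int> \<times> \<int>"
  then obtain z where "y = real_of_int z" by (auto elim: Ints_cases)
  then show False using ne_int_if_between assms by blast
qed

lemma in_vertical_edges:
  assumes "real_of_int (snd e) \<le> y" "y \<le> real_of_int (snd e) + 1"
    and "x = real_of_int (fst e) \<or> x = real_of_int (fst e) + 1"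
  shows "(x, y) \<in> vertical_edges e"
  using assms by (auto simp: vertical_edges_def)

lemma in_horizontal_edges:
  assumes "real_of_int (fst e) \<le> x" "x \<le> real_of_int (fst e) + 1"
    and "y = real_of_int (snd e) \<or> y = real_of_int (snd e) + 1"
  shows "(x, y) \<in> horizontal_edges e"
  using assms by (auto simp: horizontal_edges_def)

lemma not_in_horizontal_edges:
  assumes "real_of_int k < y" "y < real_of_int k + 1"
  shows "(x, y) \<notin> horizontal_edges e"
proof
  assume "(x, y) \<in> horizontal_edges e"
  then have "y = real_of_int (snd e) \<or> y = real_of_int (snd e) + 1"
    by (auto simp: horizontal_edges_def)
  then show False using ne_int_if_between ne_int_plus_one_if_between assms by blast
qed

section \<open>Widening a row\<close>

text \<open>The abscissa, relative to brick number 0 of the row, at which side hit number \<open>j\<close> takes place.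
  Even hits are at the right end.\<close>

definition wall :: "nat \<Rightarrow> int" where
  "wall j = (if even j then int (j div 2) else - int (j div 2) - 1)"

definition side_brick :: "nat \<Rightarrow> int" where
  "side_brick j = (if even j then wall j else wall j - 1)"

text \<open>The horizontal direction of the ball after side hit number \<open>j\<close>.\<close>

definition heading :: "nat \<Rightarrow> int" where
  "heading j = (if even j then -1 else 1)"

text \<open>The horizontal distance covered before side hit number \<open>j\<close>: pass \<open>i\<close>, which ends with
  hit \<open>i\<close>, has length \<open>i\<close>.\<close>

definition run :: "nat \<Rightarrow> real" where
  "run j = real j * (real j + 1) / 2"

lemma run_Suc: "run (Suc j) = run j + real j + 1"
  by (simp add: run_def field_simps)

lemma run_less_run_Suc: "run j < run (Suc j)"
  by (simp add: run_Suc)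

lemma run_mono: "i \<le> j \<Longrightarrow> run i \<le> run j"
  by (auto simp: run_def intro!: mult_mono divide_right_mono)

lemma run_even: "run (2 * k) = real k * (2 * real k + 1)"
  by (simp add: run_def field_simps)

lemma run_before_even: "0 < k \<Longrightarrow> run (2 * k - 1) = real k * (2 * real k - 1)"
  by (simp add: run_def field_simps of_nat_diff)

lemma wall_Suc: "wall (Suc j) = wall j + heading j * (int j + 1)"
  unfolding wall_def heading_def by (cases "even j") (auto elim!: evenE oddE)

lemma heading_Suc: "heading (Suc j) = - heading j"
  by (simp add: heading_def)

lemma inj_side_brick: "side_brick i = side_brick j \<Longrightarrow> i = j"
  by (auto simp: side_brick_def wall_def elim!: evenE oddE split: if_splits)

lemma side_brick_ne_start: "side_brick j \<noteq> -1"
  by (auto simp: side_brick_def wall_def split: if_splits)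

lemma side_brick_less: "j < 2 * v \<Longrightarrow> side_brick j < int v"
  by (auto simp: side_brick_def wall_def split: if_splits)

text \<open>The corridor has no gaps: apart from the initial hole in column -1, the columns between two
  consecutive walls are those of the bricks of the earlier side hits.\<close>

lemma row_free_between_walls:
  assumes "min (wall j) (wall (Suc j)) \<le> k" "k < max (wall j) (wall (Suc j))"
  shows "k = -1 \<or> (\<exists>i\<le>j. k = side_brick i)"
proof -
  have "k = side_brick (2 * nat k)" if "0 \<le> k"
    using that by (auto simp: side_brick_def wall_def)
  moreover have "k = side_brick (2 * nat (-2 - k) + 1)" if "k < -1"
    using that by (auto simp: side_brick_def wall_def)
  moreover have "2 * nat k \<le> j" if "0 \<le> k"
    using assms that by (cases "even j") (auto simp: wall_def elim!: evenE oddE)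
  moreover have "2 * nat (-2 - k) + 1 \<le> j" if "k < -1"
    using assms that by (cases "even j") (auto simp: wall_def elim!: evenE oddE)
  ultimately show ?thesis by (cases "k < -1"; cases "k = -1") (auto intro: exI[of _ "2 * nat k"])
qed

section \<open>The tower of rows\<close>

text \<open>Relative to brick number 0 of its row, the ball destroys the ceiling brick in column \<open>D - 1\<close>,
  just left of the abscissa \<open>D\<close>, and the floor brick in column \<open>F - 1\<close>. The bounds \<open>D_le\<close> and
  \<open>F_le\<close>, together with the positivity of \<open>D\<close> and \<open>F\<close>, say that the distances \<open>n\<close>, \<open>2 * n\<close> and
  \<open>3 * n\<close> fall into the passes \<open>2 * u\<close>, \<open>2 * w\<close> and \<open>2 * v\<close>. A completed row extends up to the
  column \<open>v - 1\<close>, and the floor brick of the next row is in column \<open>D + F - 1\<close> of the same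
  coordinates, so \<open>F_beyond\<close> guarantees that this floor brick is present.\<close>

locale row_tower =
  fixes u v w :: nat and D F n :: int
  assumes D_def: "D = int v ^ 2 - 3 * int u ^ 2"
    and n_def: "n = int v ^ 2 - int u ^ 2"
    and F_def: "F = 2 * n - 2 * int w ^ 2"
    and D_pos: "0 < D" and D_le: "D \<le> int u"
    and F_le: "F \<le> int w" and F_beyond: "int v < D + F"
begin

lemma u_pos: "0 < u" using D_pos D_le by linarith

lemma n_eq: "n = 2 * int u ^ 2 + D" using D_def n_def by simp

lemma two_n_eq: "2 * n = 2 * int w ^ 2 + F" using F_def by simp

lemma three_n_eq: "3 * n = 2 * int v ^ 2 + D" using D_def n_def by simp

lemma n_pos: "0 < n" using n_eq D_pos by (simp add: add_nonneg_pos)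

lemma u_less_v: "u < v"
proof -
  have "int u ^ 2 < int v ^ 2" using n_pos n_def by simp
  then show ?thesis using power_less_imp_less_base[of "int u" 2 "int v"] by simp
qed

lemma F_pos: "0 < F" using F_beyond D_le u_less_v by linarith

lemma u_less_w: "u < w"
proof (rule ccontr)
  assume "\<not> u < w"
  then have "w \<le> u" by simp
  then have "int w ^ 2 \<le> int u ^ 2" by simp
  moreover have "int u \<le> int u ^ 2" using u_pos by (simp add: self_le_power)
  ultimately show False using n_eq two_n_eq F_le D_pos \<open>w \<le> u\<close> by linarith
qed

lemma w_less_v: "w < v"
proof -
  have "0 < int u ^ 2" using u_pos by simp
  then have "int w ^ 2 < int v ^ 2" using two_n_eq F_pos n_def by linarith
  then show ?thesis using power_less_imp_less_base[of "int w" 2 "int v"] by simp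
qed

text \<open>A row accounts for the side hits 0, \<dots>, \<open>2 * v - 1\<close>, the ceiling hit, which comes just after
  side hit \<open>2 * u - 1\<close> and so is event number \<open>2 * u\<close> of the row, and the floor hit, which comes
  just after side hit \<open>2 * w - 1\<close> and so is event number \<open>2 * w + 1\<close>.\<close>

definition period :: nat where "period = 2 * v + 2"

text \<open>The number of the last side hit up to and including event \<open>i\<close> of a row.\<close>

definition hits :: "nat \<Rightarrow> nat" where
  "hits i = (if i < 2 * u then i else if i \<le> 2 * w then i - 1 else i - 2)"

text \<open>The horizontal distance, counted from event 0 of the row, at which event \<open>i\<close> takes place.\<close>

definition event_run :: "nat \<Rightarrow> real" where
  "event_run i = (if i = 2 * u then real_of_int n - 1 / 2
     else if i = 2 * w + 1 then 2 * real_of_int n - 1 / 2 else run (hits i))"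

text \<open>Height above the floor of the row and abscissa relative to its brick number 0, as functions of
  the horizontal distance \<open>X\<close>. The formulas are those valid on the flight after event \<open>i\<close>; they
  still hold at its end, and for the last event of a row they also describe the flight
  into the next row.\<close>

definition height :: "nat \<Rightarrow> real \<Rightarrow> real" where
  "height i X = (if i < 2 * u then (X + 1 / 2) / n
     else if i \<le> 2 * w then 2 - (X + 1 / 2) / n else (X + 1 / 2) / n - 2)"

definition climb :: "nat \<Rightarrow> real" where
  "climb i = (if i < 2 * u \<or> 2 * w < i then 1 else -1)"

definition abscissa :: "nat \<Rightarrow> real \<Rightarrow> real" where
  "abscissa i X = wall (hits i) + heading (hits i) * (X - run (hits i))"

definition target :: "int \<Rightarrow> nat \<Rightarrow> brick" where
  "target r i = (if i = 2 * u then (r * D + D - 1, r + 1)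
     else if i = 2 * w + 1 then (r * D + F - 1, r - 1) else (r * D + side_brick (hits i), r))"

definition ball_at :: "int \<Rightarrow> nat \<Rightarrow> real \<Rightarrow> point" where
  "ball_at r i X = (r * D + abscissa i X, r + height i X)"

definition velocity :: "nat \<Rightarrow> point" where
  "velocity i = (real_of_int (heading (hits i)), climb i / n)"

text \<open>Global numbering: rows are filled one after the other, \<open>period\<close> events each, and brick number 0
  of row \<open>r\<close> is \<open>(r * D, r)\<close>.\<close>

definition broken :: "nat \<Rightarrow> brick" where "broken m = target (int (m div period)) (m mod period)"
definition hit_point :: "nat \<Rightarrow> point" where
  "hit_point m = ball_at (int (m div period)) (m mod period) (event_run (m mod period))"
definition incoming :: "nat \<Rightarrow> point" where
  "incoming m = (case m of 0 \<Rightarrow> (1, 1 / n) | Suc k \<Rightarrow> velocity (k mod period))"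

text \<open>The meetings with ceiling and floor fall into the passes \<open>2 * u\<close>, \<open>2 * w\<close> and \<open>2 * v\<close>. The
  lower bounds leave room for the column of width 1 in which each meeting takes place.\<close>

lemma run_bounds:
  "run (2 * u - 1) \<le> n - 1" "n \<le> run (2 * u)"
  "run (2 * w - 1) \<le> 2 * n - 1" "2 * n \<le> run (2 * w)"
  "run (2 * v - 1) \<le> 3 * n - 1" "3 * n \<le> run (2 * v)"
proof -
  have i: "int u * (2 * int u - 1) \<le> n - 1" "n \<le> int u * (2 * int u + 1)"
    "int w * (2 * int w - 1) \<le> 2 * n - 1" "2 * n \<le> int w * (2 * int w + 1)"
    "int v * (2 * int v - 1) \<le> 3 * n - 1" "3 * n \<le> int v * (2 * int v + 1)"
    using n_eq two_n_eq three_n_eq D_pos D_le F_pos F_le u_less_v u_pos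
    by (simp_all add: algebra_simps power2_eq_square)
  have p: "0 < w" "0 < v" using u_less_w u_less_v by auto
  have "real_of_int (int u * (2 * int u - 1)) \<le> real_of_int (n - 1)" using i(1) by (simp only: of_int_le_iff)
  then show "run (2 * u - 1) \<le> n - 1" using run_before_even[OF u_pos] by simp
  have "real_of_int (int w * (2 * int w - 1)) \<le> real_of_int (2 * n - 1)" using i(3) by (simp only: of_int_le_iff)
  then show "run (2 * w - 1) \<le> 2 * n - 1" using run_before_even[OF p(1)] by simp
  have "real_of_int (int v * (2 * int v - 1)) \<le> real_of_int (3 * n - 1)" using i(5) by (simp only: of_int_le_iff)
  then show "run (2 * v - 1) \<le> 3 * n - 1" using run_before_even[OF p(2)] by simp
  have "real_of_int n \<le> real_of_int (int u * (2 * int u + 1))" using i(2) by (simp only: of_int_le_iff)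
  then show "n \<le> run (2 * u)" by (simp add: run_even)
  have "real_of_int (2 * n) \<le> real_of_int (int w * (2 * int w + 1))" using i(4) by (simp only: of_int_le_iff)
  then show "2 * n \<le> run (2 * w)" by (simp add: run_even)
  have "real_of_int (3 * n) \<le> real_of_int (int v * (2 * int v + 1))" using i(6) by (simp only: of_int_le_iff)
  then show "3 * n \<le> run (2 * v)" by (simp add: run_even)
qed

lemma event_run_zero: "event_run 0 = 0" "hits 0 = 0"
  using u_pos u_less_w by (auto simp: event_run_def hits_def run_def)

lemma hits_Suc: "hits (Suc i) = (if Suc i = 2 * u \<or> Suc i = 2 * w + 1 then hits i else Suc (hits i))"
  using u_pos u_less_w by (auto simp: hits_def)

text \<open>The horizontal distance at which the current rising or falling phase of the ball starts, that is,
  at which its straightened path meets the horizontal grid line it came from. For the first phase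
  this is the backward extension of the path below its starting point, to height 0.\<close>

definition phase_start :: "nat \<Rightarrow> real" where
  "phase_start i = (if i < 2 * u then - 1 / 2 else if i \<le> 2 * w then n - 1 / 2 else 2 * n - 1 / 2)"

lemma height_open:
  assumes "phase_start i < X" "X < phase_start i + n"
  shows "0 < height i X" "height i X < 1"
  using assms n_pos by (auto simp: height_def phase_start_def field_simps split: if_splits)

lemma hit_within_phase:
  assumes "i < period" "i \<noteq> 2 * u" "i \<noteq> 2 * w + 1"
  shows "phase_start i < run (hits i)" "run (hits i) < phase_start i + n"
proof -
  consider "i < 2 * u" | "2 * u < i" "i \<le> 2 * w" | "2 * w + 1 < i" using assms by linarith
  then have "phase_start i < run (hits i) \<and> run (hits i) < phase_start i + n"
  proof cases
    case 1
    then have "run 0 \<le> run i" "run i \<le> run (2 * u - 1)" by (intro run_mono; simp)+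
    moreover have "run 0 = 0" by (simp add: run_def)
    ultimately show ?thesis using 1 run_bounds(1) by (simp add: hits_def phase_start_def)
  next
    case 2
    then have "run (2 * u) \<le> run (hits i)" "run (hits i) \<le> run (2 * w - 1)"
      by (intro run_mono; simp add: hits_def)+
    then show ?thesis using 2 run_bounds by (simp add: phase_start_def)
  next
    case 3
    then have "run (2 * w) \<le> run (hits i)" "run (hits i) \<le> run (2 * v - 1)"
      using u_less_w assms(1) by (intro run_mono; simp add: hits_def period_def)+
    then show ?thesis using 3 run_bounds u_less_w by (simp add: phase_start_def)
  qed
  then show "phase_start i < run (hits i)" "run (hits i) < phase_start i + n" by auto
qed

lemma event_within_phase:
  assumes "i < period" shows "phase_start i \<le> event_run i" "event_run i < phase_start i + n"
  using hit_within_phase[OF assms] u_less_w n_pos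
  by (auto simp: event_run_def phase_start_def)

lemma event_within_pass:
  assumes "i < period" shows "run (hits i) \<le> event_run i" "event_run i < run (Suc (hits i))"
proof -
  have "hits (2 * u) = 2 * u - 1" "hits (2 * w + 1) = 2 * w - 1" "Suc (2 * u - 1) = 2 * u"
    "Suc (2 * w - 1) = 2 * w" using u_less_w u_pos by (auto simp: hits_def)
  then have "run (hits i) \<le> event_run i \<and> event_run i < run (Suc (hits i))"
    using run_bounds run_less_run_Suc[of "hits i"] by (auto simp: event_run_def)
  then show "run (hits i) \<le> event_run i" "event_run i < run (Suc (hits i))" by auto
qed

text \<open>Between consecutive events the ball stays within one pass and within one phase, and the
  formulas attached to the two events agree at the later one.\<close>

lemma next_event:
  assumes "Suc i < period"
  shows "event_run i < event_run (Suc i)" "event_run (Suc i) \<le> run (Suc (hits i))"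
    "event_run (Suc i) \<le> phase_start i + n"
    "abscissa i (event_run (Suc i)) = abscissa (Suc i) (event_run (Suc i))"
    "height i (event_run (Suc i)) = height (Suc i) (event_run (Suc i))"
proof -
  have h: "event_run (Suc i) = run (Suc (hits i)) \<and> hits (Suc i) = Suc (hits i)
      \<and> phase_start (Suc i) = phase_start i"
    if "Suc i \<noteq> 2 * u" "Suc i \<noteq> 2 * w + 1"
    using that u_less_w by (auto simp: event_run_def hits_Suc phase_start_def)
  show "event_run (Suc i) \<le> run (Suc (hits i))"
  proof (cases "Suc i = 2 * u \<or> Suc i = 2 * w + 1")
    case True
    then have "hits (Suc i) = hits i" by (simp add: hits_Suc)
    then show ?thesis using event_within_pass(2)[OF assms] by simp
  qed (use h in auto)
  show e: "event_run i < event_run (Suc i)"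
  proof (cases "Suc i = 2 * u \<or> Suc i = 2 * w + 1")
    case True
    then have "i < 2 * u \<and> event_run (Suc i) = phase_start i + n
      \<or> 2 * u \<le> i \<and> i \<le> 2 * w \<and> event_run (Suc i) = phase_start i + n"
      using u_less_w by (auto simp: event_run_def phase_start_def)
    then show ?thesis using event_within_phase(2)[of i] assms by auto
  next
    case False
    then show ?thesis using h event_within_pass(2)[of i] assms by auto
  qed
  show "event_run (Suc i) \<le> phase_start i + n"
  proof (cases "Suc i = 2 * u \<or> Suc i = 2 * w + 1")
    case True
    then show ?thesis using u_less_w by (auto simp: event_run_def phase_start_def)
  next
    case False
    then show ?thesis using h event_within_phase(2)[OF assms] by auto
  qed
  show "abscissa i (event_run (Suc i)) = abscissa (Suc i) (event_run (Suc i))"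
  proof (cases "Suc i = 2 * u \<or> Suc i = 2 * w + 1")
    case True
    then have "hits (Suc i) = hits i" by (simp add: hits_Suc)
    then show ?thesis by (simp add: abscissa_def)
  next
    case False
    then show ?thesis using h by (simp add: abscissa_def wall_Suc run_Suc)
  qed
  show "height i (event_run (Suc i)) = height (Suc i) (event_run (Suc i))"
    using u_less_w n_pos by (auto simp: height_def event_run_def field_simps)
qed

lemma abscissa_between_walls:
  assumes "run (hits i) < X" "X < run (Suc (hits i))"
  shows "real_of_int (min (wall (hits i)) (wall (Suc (hits i)))) < abscissa i X"
    "abscissa i X < real_of_int (max (wall (hits i)) (wall (Suc (hits i))))"
  using assms by (auto simp: abscissa_def wall_Suc run_Suc heading_def min_def max_def)

lemma ball_at_move: "ball_at r i (X + s) = ball_at r i X + s *\<^sub>R velocity i"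
  using n_pos by (auto simp: ball_at_def velocity_def abscissa_def height_def climb_def field_simps)


lemma hits_less: "i < period \<Longrightarrow> hits i < 2 * v"
  using u_less_v w_less_v u_less_w by (auto simp: hits_def period_def)

lemma hits_strict_mono:
  assumes "i < k" "k \<noteq> 2 * u" "k \<noteq> 2 * w + 1"
  shows "hits i < hits k"
  using assms u_pos u_less_w by (auto simp: hits_def)

text \<open>No brick is needed twice. The side bricks of a row are distinct, and the only brick of a row
  destroyed before its side hits is the one in column -1, removed from below. The case that uses the choice of \<open>(u, v, w)\<close> is a floor hit against the side bricks of
  the preceding row.\<close>

lemma target_new:
  assumes "i < period" "k < period" "r' < r \<or> r' = r \<and> k < i"
  shows "target (int r') k \<noteq> target (int r) i"
proof
  assume eq: "target (int r') k = target (int r) i"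
  have "side_brick (hits k) < int v" using side_brick_less hits_less assms(2) by blast
  then have side_ne: "side_brick (hits k) \<noteq> D + F - 1" using F_beyond by linarith
  have shift: "int (r' + 1) * D = int r' * D + D" "int (r' + 2) * D = int r' * D + 2 * D"
    by (simp_all add: distrib_right)
  consider (ceil) "i = 2 * u" | (floor) "i = 2 * w + 1" | (side) "i \<noteq> 2 * u" "i \<noteq> 2 * w + 1" by blast
  then show False
  proof cases
    case ceil
    then show False using eq assms(3) u_less_w by (auto simp: target_def split: if_splits)
  next
    case floor
    then have i: "target (int r) i = (int r * D + F - 1, int r - 1)" using u_less_w by (simp add: target_def)
    have k: "fst (target (int r') k) = int r * D + F - 1" "snd (target (int r') k) = int r - 1"
      by (simp_all add: eq i)
    consider "k = 2 * u" "r = r' + 2" | "k = 2 * w + 1" "r = r'"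
      | "k \<noteq> 2 * u" "k \<noteq> 2 * w + 1" "r = r' + 1"
      using k(2) by (auto simp: target_def split: if_splits)
    then show False
    proof cases
      case 1
      then have "int r * D = int r' * D + 2 * D" using shift(2) by (simp only:)
      moreover have "int r' * D + D - 1 = int r * D + F - 1" using k(1) 1 by (simp add: target_def)
      ultimately show False using D_pos F_pos by linarith
    next
      case 2
      then show False using assms(3) floor by simp
    next
      case 3
      then have "int r * D = int r' * D + D" using shift(1) by (simp only:)
      moreover have "int r' * D + side_brick (hits k) = int r * D + F - 1" using k(1) 3 by (simp add: target_def)
      ultimately show False using side_ne by linarith
    qed
  next
    case side
    then have i: "target (int r) i = (int r * D + side_brick (hits i), int r)" by (simp add: target_def)
    have k: "fst (target (int r') k) = int r * D + side_brick (hits i)" "snd (target (int r') k) = int r"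
      by (simp_all add: eq i)
    consider "k = 2 * u" "r = r' + 1" | "k \<noteq> 2 * u" "k \<noteq> 2 * w + 1" "r = r'"
      using k(2) assms(3) by (auto simp: target_def split: if_splits)
    then show False
    proof cases
      case 1
      then have "int r * D = int r' * D + D" using shift(1) by (simp only:)
      moreover have "int r' * D + D - 1 = int r * D + side_brick (hits i)" using k(1) 1 by (simp add: target_def)
      ultimately show False using side_brick_ne_start[of "hits i"] by linarith
    next
      case 2
      then have "side_brick (hits k) = side_brick (hits i)"
        using k(1) by (simp add: target_def)
      moreover have "hits k < hits i" using hits_strict_mono[OF _ side, of k] assms(3) 2 by simp
      ultimately show False using inj_side_brick by fastforce
    qed
  qed
qed

lemma target_ne_hole: "target (int r) i \<noteq> (-1, 0)"
proof (cases "r \<le> 1")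
  case True
  then consider "r = 0" | "r = 1" by linarith
  then show ?thesis using side_brick_ne_start[of "hits i"] D_pos F_pos F_beyond
    by cases (auto simp: target_def)
qed (auto simp: target_def)

lemma period_pos: "0 < period" by (simp add: period_def)

lemma div_mod_period:
  assumes "i < period" shows "(r * period + i) div period = r" "(r * period + i) mod period = i"
  using assms by auto

lemma broken_eq: "i < period \<Longrightarrow> broken (r * period + i) = target (int r) i"
  by (simp add: broken_def div_mod_period)

lemma earlier_event:
  assumes "m < r * period + i" "i < period"
  shows "m div period < r \<or> m div period = r \<and> m mod period < i"
proof -
  have "m div period \<le> (r * period + i) div period" using assms(1) by (intro div_le_mono) simp
  then have "m div period \<le> r" using div_mod_period[OF assms(2)] by simp
  moreover have "m = m div period * period + m mod period" by simp
  ultimately show ?thesis using assms(1) by (metis le_neq_implies_less nat_add_left_cancel_less)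
qed

lemma target_present: 
  assumes "i < period"
  shows "target (int r) i \<in> present broken (r * period + i)"
proof -
  have "broken m \<noteq> target (int r) i" if "m < r * period + i" for m
    unfolding broken_def
    using target_new[OF assms, of "m mod period" "m div period" r] earlier_event[OF that assms] period_pos
    by simp
  then have "target (int r) i \<notin> broken ` {..<r * period + i}" by force
  then show ?thesis using target_ne_hole by (simp add: present_def)
qed

text \<open>The hole through which the ball passes from row \<open>r\<close> to row \<open>r + 1\<close>.\<close>

lemma gate_free:
  assumes "r * period + 2 * u \<le> m"
  shows "(int r * D + D - 1, int r + 1) \<notin> present broken (Suc m)"
proof -
  have "2 * u < period" using u_less_v by (simp add: period_def)
  then have "broken (r * period + 2 * u) = (int r * D + D - 1, int r + 1)"
    using broken_eq[of "2 * u" r] by (simp add: target_def)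
  moreover have "r * period + 2 * u \<in> {..<Suc m}" using assms by simp
  ultimately show ?thesis unfolding present_def by (metis DiffE image_eqI)
qed

text \<open>Every side hit number up to the current one belongs to an earlier event of the row; the
  witness inverts \<open>hits\<close> on the events that are side hits.\<close>

lemma side_hit_exists:
  assumes "i < period" "j \<le> hits i"
  shows "\<exists>k\<le>i. k \<noteq> 2 * u \<and> k \<noteq> 2 * w + 1 \<and> hits k = j"
proof -
  define k where "k = (if j < 2 * u then j else if j < 2 * w then j + 1 else j + 2)"
  have "k \<le> i \<and> k \<noteq> 2 * u \<and> k \<noteq> 2 * w + 1 \<and> hits k = j"
    using assms u_pos u_less_w by (auto simp: k_def hits_def split: if_splits)
  then show ?thesis by blast
qed

text \<open>The part of row \<open>r\<close> in which the ball moves after event \<open>i\<close> is free. Its column -1 is the missing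
  brick for the lowest row and the gate from the row below otherwise.\<close>

lemma row_free:
  assumes "i < period"
    and "min (wall (hits i)) (wall (Suc (hits i))) \<le> k" "k < max (wall (hits i)) (wall (Suc (hits i)))"
  shows "(int r * D + k, int r) \<notin> present broken (Suc (r * period + i))"
  using row_free_between_walls[OF assms(2,3)]
proof
  assume k: "k = -1"
  show ?thesis
  proof (cases r)
    case 0
    then show ?thesis using k by (simp add: present_def)
  next
    case (Suc r')
    have "r' * period + 2 * u \<le> r * period + i" using Suc u_less_v by (simp add: period_def)
    from gate_free[OF this] show ?thesis using Suc k by (simp add: algebra_simps)
  qed
next
  assume "\<exists>j\<le>hits i. k = side_brick j"
  then obtain j where j: "j \<le> hits i" "k = side_brick j" by blast
  obtain l where l: "l \<le> i" "l \<noteq> 2 * u" "l \<noteq> 2 * w + 1" "hits l = j"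
    using side_hit_exists[OF assms(1) j(1)] by blast
  have "broken (r * period + l) = (int r * D + k, int r)"
    using l j assms(1) broken_eq[of l r] by (simp add: target_def)
  moreover have "r * period + l \<in> {..<Suc (r * period + i)}" using l by simp
  ultimately show ?thesis unfolding present_def by (metis DiffE image_eqI)
qed

lemma ceiling_hit: "abscissa (2 * u) (event_run (2 * u)) = D - 1 / 2"
  "height (2 * u) (event_run (2 * u)) = 1"
proof -
  have h: "hits (2 * u) = 2 * u - 1" using u_less_w by (simp add: hits_def)
  have "wall (2 * u - 1) = - int u" using u_pos by (auto simp: wall_def)
  moreover have "heading (2 * u - 1) = 1" using u_pos by (simp add: heading_def)
  moreover have "real_of_int n = 2 * real u ^ 2 + D" using arg_cong[OF n_eq, of real_of_int] by simp
  ultimately show "abscissa (2 * u) (event_run (2 * u)) = D - 1 / 2"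
    using run_before_even[OF u_pos] unfolding abscissa_def h
    by (simp add: event_run_def algebra_simps power2_eq_square)
  show "height (2 * u) (event_run (2 * u)) = 1"
    using u_less_w n_pos by (simp add: height_def event_run_def)
qed

lemma floor_hit: "abscissa (2 * w + 1) (event_run (2 * w + 1)) = F - 1 / 2"
  "height (2 * w + 1) (event_run (2 * w + 1)) = 0"
proof -
  have w: "0 < w" using u_less_w by simp
  have h: "hits (2 * w + 1) = 2 * w - 1" using u_less_w by (simp add: hits_def)
  have "wall (2 * w - 1) = - int w" using w by (auto simp: wall_def)
  moreover have "heading (2 * w - 1) = 1" using w by (simp add: heading_def)
  moreover have "2 * real_of_int n = 2 * real w ^ 2 + F" using arg_cong[OF two_n_eq, of real_of_int] by simp
  ultimately show "abscissa (2 * w + 1) (event_run (2 * w + 1)) = F - 1 / 2"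
    using run_before_even[OF w] u_less_w unfolding abscissa_def h
    by (simp add: event_run_def algebra_simps power2_eq_square)
  show "height (2 * w + 1) (event_run (2 * w + 1)) = 0"
    using u_less_w n_pos by (simp add: height_def event_run_def)
qed

lemma side_hit:
  assumes "i < period" "i \<noteq> 2 * u" "i \<noteq> 2 * w + 1"
  shows "abscissa i (event_run i) = wall (hits i)"
    "0 < height i (event_run i)" "height i (event_run i) < 1"
  using assms hit_within_phase[OF assms] height_open[of i "run (hits i)"]
  by (auto simp: abscissa_def event_run_def)

lemma event_not_lattice:
  assumes "i < period" shows "ball_at (int r) i (event_run i) \<notin> \<int> \<times> \<int>"
proof -
  consider (ceil) "i = 2 * u" | (floor) "i = 2 * w + 1" | (side) "i \<noteq> 2 * u" "i \<noteq> 2 * w + 1" by blast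
  then show ?thesis
  proof cases
    case ceil
    then show ?thesis unfolding ball_at_def using ceiling_hit
      by (intro not_lattice_fst[of "int r * D + D - 1"]) auto
  next
    case floor
    then show ?thesis unfolding ball_at_def using floor_hit
      by (intro not_lattice_fst[of "int r * D + F - 1"]) auto
  next
    case side
    then show ?thesis unfolding ball_at_def using side_hit[OF assms side]
      by (intro not_lattice_snd[of "int r"]) auto
  qed
qed

lemma event_on_edge:
  assumes "i < period"
  shows "ball_at (int r) i (event_run i) \<in> edges (target (int r) i)"
    "ball_at (int r) i (event_run i) \<in> horizontal_edges (target (int r) i) \<longleftrightarrow> i = 2 * u \<or> i = 2 * w + 1"
proof -
  consider (ceil) "i = 2 * u" | (floor) "i = 2 * w + 1" | (side) "i \<noteq> 2 * u" "i \<noteq> 2 * w + 1" by blast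
  then have "ball_at (int r) i (event_run i) \<in> edges (target (int r) i) \<and>
    (ball_at (int r) i (event_run i) \<in> horizontal_edges (target (int r) i) \<longleftrightarrow> i = 2 * u \<or> i = 2 * w + 1)"
  proof cases
    case ceil
    then have "ball_at (int r) i (event_run i) \<in> horizontal_edges (target (int r) i)"
      unfolding ball_at_def target_def using ceiling_hit by (intro in_horizontal_edges) auto
    then show ?thesis using ceil by (simp add: edges_def)
  next
    case floor
    then have "ball_at (int r) i (event_run i) \<in> horizontal_edges (target (int r) i)"
      unfolding ball_at_def target_def using floor_hit u_less_w by (intro in_horizontal_edges) auto
    then show ?thesis using floor by (simp add: edges_def)
  next
    case side
    then have "ball_at (int r) i (event_run i) \<in> vertical_edges (target (int r) i)"
      unfolding ball_at_def target_def using side_hit[OF assms side] 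
      by (intro in_vertical_edges) (auto simp: side_brick_def)
    moreover have "ball_at (int r) i (event_run i) \<notin> horizontal_edges (target (int r) i)"
      unfolding ball_at_def using side_hit[OF assms side] by (intro not_in_horizontal_edges[of "int r"]) auto
    ultimately show ?thesis using side by (simp add: edges_def)
  qed
  then show "ball_at (int r) i (event_run i) \<in> edges (target (int r) i)"
    "ball_at (int r) i (event_run i) \<in> horizontal_edges (target (int r) i) \<longleftrightarrow> i = 2 * u \<or> i = 2 * w + 1"
    by auto
qed

lemma clear_inside_row:
  assumes "i < period" "event_run i < X" "X < run (Suc (hits i))" "X < phase_start i + n"
  shows "ball_at (int r) i X \<notin> \<int> \<times> \<int>"
    and "d \<in> present broken (Suc (r * period + i)) \<Longrightarrow> ball_at (int r) i X \<notin> edges d"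
proof -
  have X: "run (hits i) < X" "phase_start i < X"
    using assms event_within_pass(1) event_within_phase(1) by (meson order.strict_trans1)+
  have h: "0 < height i X" "height i X < 1" using height_open X assms by blast+
  then show "ball_at (int r) i X \<notin> \<int> \<times> \<int>"
    unfolding ball_at_def by (intro not_lattice_snd[of "int r"]) auto
  assume d: "d \<in> present broken (Suc (r * period + i))"
  let ?a = "min (wall (hits i)) (wall (Suc (hits i)))" and ?b = "max (wall (hits i)) (wall (Suc (hits i)))"
  have free: "(k, int r) \<notin> present broken (Suc (r * period + i))" if "int r * D + ?a \<le> k" "k < int r * D + ?b" for k
    using row_free[OF assms(1), of "k - int r * D" r] that by (simp add: algebra_simps)
  have "real_of_int (int r * D + ?a) < real_of_int (int r * D) + abscissa i X"
    "real_of_int (int r * D) + abscissa i X < real_of_int (int r * D + ?b)"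
    using abscissa_between_walls[OF X(1) assms(3)] by (simp_all only: of_int_add)
  then show "ball_at (int r) i X \<notin> edges d"
    unfolding ball_at_def using h free d
    by (intro not_on_edge_inside_row[of "int r" _ "int r * D + ?a" _ "int r * D + ?b"]) auto
qed


lemma flight_within_row:
  assumes "Suc i < period"
  shows "flight (present broken (Suc (r * period + i))) (hit_point (r * period + i)) (velocity i)
    (broken (Suc (r * period + i))) (hit_point (Suc (r * period + i)))"
proof -
  have i: "i < period" using assms by simp
  have CQ: "hit_point (r * period + i) = ball_at (int r) i (event_run i)"
    "broken (Suc (r * period + i)) = target (int r) (Suc i)"
    "hit_point (Suc (r * period + i)) = ball_at (int r) (Suc i) (event_run (Suc i))"
    using div_mod_period[OF i, of r] div_mod_period[OF assms, of r] by (simp_all add: broken_def hit_point_def)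
  define t where "t = event_run (Suc i) - event_run i"
  have end_point: "ball_at (int r) (Suc i) (event_run (Suc i)) = ball_at (int r) i (event_run (Suc i))"
    using next_event(4,5)[OF assms] by (simp add: ball_at_def)
  have move: "ball_at (int r) i (event_run i) + s *\<^sub>R velocity i = ball_at (int r) i (event_run i + s)" for s
    by (rule ball_at_move[symmetric])
  have clear: "event_run i < X \<Longrightarrow> X < event_run (Suc i) \<Longrightarrow> X < run (Suc (hits i)) \<and> X < phase_start i + n" for X
    using next_event(2,3)[OF assms] by linarith
  show ?thesis
    unfolding flight_def CQ move
  proof (intro exI[of _ t] conjI ballI)
    show "0 < t" using next_event(1)[OF assms] by (simp add: t_def)
    show "ball_at (int r) (Suc i) (event_run (Suc i)) = ball_at (int r) i (event_run i + t)"
      by (simp add: t_def end_point)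
    show "target (int r) (Suc i) \<in> present broken (Suc (r * period + i))"
      using target_present[OF assms, of r] by simp
    show "ball_at (int r) (Suc i) (event_run (Suc i)) \<in> edges (target (int r) (Suc i))"
      by (rule event_on_edge(1)[OF assms])
  next
    fix s d assume "s \<in> {0<..<t}" "d \<in> present broken (Suc (r * period + i))"
    then show "ball_at (int r) i (event_run i + s) \<notin> edges d"
      using clear_inside_row(2)[OF i, of "event_run i + s"] clear[of "event_run i + s"] by (simp add: t_def)
  next
    fix s assume "s \<in> {0..t}"
    then consider "s = 0" | "s = t" | "0 < s" "s < t" by fastforce
    then show "ball_at (int r) i (event_run i + s) \<notin> \<int> \<times> \<int>"
    proof cases
      case 1
      then show ?thesis using event_not_lattice[OF i, of r] by simp
    next
      case 2
      then show ?thesis using event_not_lattice[OF assms, of r] end_point by (simp add: t_def)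
    next
      case 3
      then show ?thesis
        using clear_inside_row(1)[OF i, of "event_run i + s"] clear[of "event_run i + s"] by (simp add: t_def)
    qed
  qed
qed

text \<open>The flight after the last event of a row goes to the right in pass \<open>2 * v\<close>; at the distance
  \<open>3 * n\<close> it has the abscissa \<open>D\<close>, the left edge of brick number 0 of the next row.\<close>

lemma last_pass:
  fixes X :: real
  assumes "i = period - 1"
  shows "i < period" "hits i = 2 * v - 1" "Suc (hits i) = 2 * v" "phase_start i = 2 * n - 1 / 2"
    "velocity i = (1, 1 / n)" "event_run i \<le> 3 * n - 1"
    "abscissa i X = D + (X - 3 * n)" "height i X = (X + 1 / 2) / n - 2"
proof -
  have v: "0 < v" using u_less_v by simp
  show "i < period" "hits i = 2 * v - 1" "Suc (hits i) = 2 * v" "phase_start i = 2 * n - 1 / 2"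
    "height i X = (X + 1 / 2) / n - 2"
    using assms w_less_v u_less_w by (auto simp: period_def hits_def phase_start_def height_def)
  note h = \<open>hits i = 2 * v - 1\<close>
  have hd: "heading (2 * v - 1) = 1" using v by (simp add: heading_def)
  show "velocity i = (1, 1 / n)"
    using assms w_less_v unfolding velocity_def h hd by (simp add: climb_def period_def)
  have "event_run i = run (2 * v - 1)"
    using assms w_less_v u_less_w h by (simp add: event_run_def period_def)
  then show "event_run i \<le> 3 * n - 1" using run_bounds(5) by simp
  have "wall (2 * v - 1) = - int v" using v by (auto simp: wall_def)
  moreover have "3 * real_of_int n = 2 * real v ^ 2 + D" using arg_cong[OF three_n_eq, of real_of_int] by simp
  ultimately show "abscissa i X = D + (X - 3 * n)"
    using run_before_even[OF v] unfolding abscissa_def h hd by (simp add: algebra_simps power2_eq_square)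
qed

text \<open>The flight through the gate. Up to distance \<open>3 * n - 1 / 2\<close> it is inside row \<open>r\<close>, at this
  distance it crosses the grid line in the middle of the gate, and the remaining horizontal distance
  \<open>1 / 2\<close> brings it to the right wall of the gate, which belongs to brick number 0 of the next row.\<close>

lemma flight_to_next_row:
  assumes "i = period - 1"
  shows "flight (present broken (Suc (r * period + i))) (hit_point (r * period + i)) (velocity i)
    (broken (Suc (r * period + i))) (hit_point (Suc (r * period + i)))"
proof -
  note L = last_pass[OF assms]
  have Sm: "Suc (r * period + i) = Suc r * period + 0" using assms period_pos by simp
  have CQ: "hit_point (r * period + i) = ball_at (int r) i (event_run i)"
    "broken (Suc (r * period + i)) = target (int (Suc r)) 0"
    "hit_point (Suc (r * period + i)) = ball_at (int (Suc r)) 0 (event_run 0)"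
    using div_mod_period[OF L(1), of r] div_mod_period[OF period_pos, of "Suc r"] unfolding Sm
    by (simp_all only: broken_def hit_point_def)
  define t where "t = 3 * n - event_run i"
  have end_point: "ball_at (int (Suc r)) 0 (event_run 0) = ball_at (int r) i (3 * n)"
  proof -
    have "abscissa 0 (event_run 0) = 0" "height 0 (event_run 0) = 1 / (2 * n)"
      using u_pos by (simp_all add: event_run_zero abscissa_def wall_def run_def height_def)
    moreover have "abscissa i (3 * n) = D" "height i (3 * n) = 1 + 1 / (2 * n)"
      unfolding L(7,8) using n_pos by (simp_all add: field_simps)
    ultimately show ?thesis unfolding ball_at_def by (simp add: distrib_right)
  qed
  have move: "ball_at (int r) i (event_run i) + s *\<^sub>R velocity i = ball_at (int r) i (event_run i + s)" for s
    by (rule ball_at_move[symmetric])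
  define P where "P = present broken (Suc (r * period + i))"
  have gate: "(int r * D + D - 1, int r + 1) \<notin> P"
    unfolding P_def using assms u_less_v by (intro gate_free) (simp add: period_def)
  \<comment> \<open>The column of the gate lies within the widened row \<open>r\<close>, since \<open>0 < D\<close> and \<open>D < v\<close>.\<close>
  have below: "(int r * D + D - 1, int r) \<notin> P"
  proof -
    have "wall (hits i) = - int v" "wall (Suc (hits i)) = int v"
      using L(2) u_less_v by (auto simp: wall_def)
    then have "(int r * D + (D - 1), int r) \<notin> P"
      unfolding P_def using D_pos D_le u_less_v by (intro row_free[OF L(1)]) auto
    then show ?thesis by (simp add: algebra_simps)
  qed
  have clear: "ball_at (int r) i X \<notin> \<int> \<times> \<int> \<and> (\<forall>d\<in>P. ball_at (int r) i X \<notin> edges d)"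
    if X: "event_run i < X" "X < 3 * n" for X
  proof -
    consider "X < 3 * n - 1 / 2" | "X = 3 * n - 1 / 2" | "3 * n - 1 / 2 < X" by linarith
    then show ?thesis
    proof cases
      case 1
      then show ?thesis using clear_inside_row[OF L(1) X(1)] run_bounds(6) L(3,4) unfolding P_def by auto
    next
      case 2
      then have h: "height i X = 1" using n_pos by (simp add: L(8))
      have a: "abscissa i X = D - 1 / 2" using 2 by (simp add: L(7))
      have "ball_at (int r) i X = (int r * D + D - 1 / 2, real_of_int (int r + 1))"
        by (simp add: ball_at_def h a)
      then show ?thesis using gate below
        not_on_edge_at_crossing[of "int r * D + D - 1" "int r * D + D - 1 / 2" "int r + 1" P]
        not_lattice_fst[of "int r * D + D - 1" "int r * D + D - 1 / 2"] by simp
    next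
      case 3
      then have h: "1 < height i X" "height i X < 2" using n_pos X(2) by (simp_all add: L(8) field_simps)
      have a: "D - 1 < abscissa i X" "abscissa i X < D" using 3 X(2) by (simp_all add: L(7))
      have free: "(k, int r + 1) \<notin> P" if "int r * D + D - 1 \<le> k" "k < int r * D + D" for k
      proof -
        have "k = int r * D + D - 1" using that by linarith
        then show ?thesis using gate by simp
      qed
      have "\<forall>d\<in>P. ball_at (int r) i X \<notin> edges d"
        unfolding ball_at_def using h a free
        by (intro ballI not_on_edge_inside_row[of "int r + 1" _ "int r * D + D - 1" _ "int r * D + D" P]) auto
      moreover have "ball_at (int r) i X \<notin> \<int> \<times> \<int>"
        unfolding ball_at_def using h by (intro not_lattice_snd[of "int r + 1"]) auto
      ultimately show ?thesis by blast
    qed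
  qed
  show ?thesis
    unfolding flight_def CQ move P_def[symmetric]
  proof (intro exI[of _ t] conjI ballI)
    show "0 < t" using L(6) by (simp add: t_def)
    show "ball_at (int (Suc r)) 0 (event_run 0) = ball_at (int r) i (event_run i + t)"
      by (simp only: t_def end_point) simp
    show "target (int (Suc r)) 0 \<in> P"
      using target_present[OF period_pos, of "Suc r"] unfolding P_def Sm .
    show "ball_at (int (Suc r)) 0 (event_run 0) \<in> edges (target (int (Suc r)) 0)"
      by (rule event_on_edge(1)[OF period_pos])
  next
    fix s d assume "s \<in> {0<..<t}" "d \<in> P"
    then show "ball_at (int r) i (event_run i + s) \<notin> edges d"
      using clear[of "event_run i + s"] by (simp add: t_def)
  next
    fix s assume "s \<in> {0..t}"
    then consider "s = 0" | "s = t" | "0 < s" "s < t" by fastforce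
    then show "ball_at (int r) i (event_run i + s) \<notin> \<int> \<times> \<int>"
    proof cases
      case 1
      then show ?thesis using event_not_lattice[OF L(1), of r] by simp
    next
      case 2
      then have "event_run i + s = 3 * n" by (simp add: t_def)
      then show ?thesis using event_not_lattice[OF period_pos, of "Suc r"] end_point by simp
    next
      case 3
      then show ?thesis using clear[of "event_run i + s"] by (simp add: t_def)
    qed
  qed
qed

text \<open>Event 0 of every row has the launch velocity as incoming velocity: for the later rows it is
  the velocity after the last event of the row below.\<close>

lemma incoming_velocity:
  assumes "i < period"
  shows "incoming (r * period + i) = (if i = 0 then (1, 1 / n) else velocity (i - 1))"
proof (cases i)
  case 0
  show ?thesis
  proof (cases r)
    case 0
    then show ?thesis using \<open>i = 0\<close> by (simp add: incoming_def)
  next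
    case (Suc r')
    then have "r * period + i = Suc (r' * period + (period - 1))" using \<open>i = 0\<close> period_pos by simp
    then have "incoming (r * period + i) = velocity ((r' * period + (period - 1)) mod period)"
      by (simp add: incoming_def)
    also have "\<dots> = (1, 1 / n)" using div_mod_period(2)[OF last_pass(1)[OF refl]] last_pass(5)[OF refl] by simp
    finally show ?thesis using \<open>i = 0\<close> by simp
  qed
next
  case (Suc k)
  then show ?thesis using assms div_mod_period(2)[of k r] by (simp add: incoming_def)
qed

lemma velocity_reflect:
  assumes "i < period"
  shows "velocity i = reflect (target (int r) i) (ball_at (int r) i (event_run i)) (incoming (r * period + i))"
proof (cases i)
  case 0
  have "incoming (r * period + i) = (1, 1 / n)" using incoming_velocity[OF assms, of r] 0 by simp
  then show ?thesis using event_on_edge(2)[OF assms, of r] 0 u_pos event_run_zero(2)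
    by (simp add: reflect_def velocity_def heading_def climb_def)
next
  case (Suc k)
  have "hits i = (if i = 2 * u \<or> i = 2 * w + 1 then hits k else Suc (hits k))"
    unfolding Suc by (rule hits_Suc)
  moreover have "incoming (r * period + i) = velocity k" using incoming_velocity[OF assms, of r] Suc by simp
  moreover have "climb i = (if i = 2 * u \<or> i = 2 * w + 1 then - climb k else climb k)"
    using Suc u_less_w by (auto simp: climb_def)
  ultimately show ?thesis using event_on_edge(2)[OF assms, of r]
    by (simp add: reflect_def velocity_def heading_Suc)
qed

lemma row_tower_orbit: "breakout_orbit (1 / (2 * n)) (1 / n) broken hit_point incoming"
proof -
  have "0 < int u ^ 2" using u_pos by simp
  then have n: "1 < n" using n_eq D_pos by linarith
  have "incoming (Suc m) = reflect (broken m) (hit_point m) (incoming m) \<and>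
    flight (present broken (Suc m)) (hit_point m) (incoming (Suc m)) (broken (Suc m)) (hit_point (Suc m))" for m
  proof -
    define r i where "r = m div period" and "i = m mod period"
    have i: "i < period" using period_pos by (simp add: i_def)
    have m: "m = r * period + i" by (simp add: r_def i_def)
    have outgoing: "incoming (Suc m) = velocity i" by (simp add: incoming_def i_def)
    have "velocity i = reflect (broken m) (hit_point m) (incoming m)"
      using velocity_reflect[OF i, of r] unfolding m[symmetric] by (simp add: broken_def hit_point_def r_def i_def)
    moreover have "flight (present broken (Suc m)) (hit_point m) (velocity i) (broken (Suc m)) (hit_point (Suc m))"
    proof (cases "Suc i < period")
      case True
      then show ?thesis unfolding m by (rule flight_within_row)
    next
      case False
      then have "i = period - 1" using i by simp
      then show ?thesis unfolding m by (rule flight_to_next_row)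
    qed
    ultimately show ?thesis unfolding outgoing by blast
  qed
  moreover have "broken 0 = (0, 0)" "hit_point 0 = (0, 1 / (2 * n))" "incoming 0 = (1, 1 / n)"
    using u_pos n by (auto simp: broken_def hit_point_def incoming_def target_def ball_at_def event_run_zero side_brick_def
      abscissa_def wall_def run_def height_def)
  moreover have "0 < 1 / real_of_int (2 * n)" "1 / real_of_int (2 * n) < 1"
    "0 < 1 / real_of_int n" "1 / real_of_int n < 1" using n by simp_all
  ultimately show ?thesis unfolding breakout_orbit_def by blast
qed

lemma symbolic_word_eq:
  "symbolic_word broken hit_point m = (if m mod period = 2 * u \<or> m mod period = 2 * w + 1 then A else B)"
  using event_on_edge(2)[of "m mod period" "m div period"] period_pos
  by (simp add: symbolic_word_def broken_def hit_point_def)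

lemma word_periodic: "periodic_word (symbolic_word broken hit_point)"
  unfolding periodic_word_def by (rule exI[of _ period]) (simp add: symbolic_word_eq period_pos)

lemma word_first_A: "(LEAST m. symbolic_word broken hit_point m = A) = 2 * u"
proof (rule Least_equality)
  have "2 * u < period" using u_less_v by (simp add: period_def)
  then show "symbolic_word broken hit_point (2 * u) = A" by (simp add: symbolic_word_eq)
  fix m assume "symbolic_word broken hit_point m = A"
  then have "m mod period = 2 * u \<or> m mod period = 2 * w + 1" by (auto simp: symbolic_word_eq split: if_splits)
  then show "2 * u \<le> m" using u_less_w mod_less_eq_dividend[of m period] by linarith
qed

end

section \<open>Infinitely many towers\<close>

text \<open>Dirichlet's theorem bounds the denominator only from above; a common factor \<open>K\<close> makes it
  large, at the price of an approximation that is \<open>K\<close> times better to begin with.\<close>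

lemma simultaneous_approximation:
  fixes \<alpha> \<beta> \<epsilon> :: real and M :: nat
  assumes "0 < \<epsilon>"
  obtains q a b :: int where "int M \<le> q" "\<bar>q * \<alpha> - a\<bar> < \<epsilon>" "\<bar>q * \<beta> - b\<bar> < \<epsilon>"
proof -
  define K where "K = Suc M"
  obtain N :: nat where N: "real K / \<epsilon> < real N" using reals_Archimedean2 by blast
  have "0 < real K / \<epsilon>" using assms by (simp add: K_def)
  then have "0 < N" using N by (metis of_nat_0_less_iff order.strict_trans)
  have small: "real K * (1 / N) < \<epsilon>" using N \<open>0 < N\<close> assms by (simp add: field_simps)
  obtain q p where q: "0 < q"
    and p: "\<And>i::nat. i < 2 \<Longrightarrow> \<bar>of_int q * (if i = 0 then \<alpha> else \<beta>) - of_int (p i)\<bar> < 1 / real N"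
    using Dirichlet_approx_simult[OF \<open>0 < N\<close>, of 2 "\<lambda>i. if i = 0 then \<alpha> else \<beta>"] by metis
  have scale: "\<bar>real_of_int (int K * q) * x - real_of_int (int K * y)\<bar> < \<epsilon>"
    if "\<bar>of_int q * x - of_int y\<bar> < 1 / real N" for x and y :: int
  proof -
    have "real_of_int (int K * q) * x - real_of_int (int K * y) = real K * (of_int q * x - of_int y)"
      by (simp add: algebra_simps)
    then have "\<bar>real_of_int (int K * q) * x - real_of_int (int K * y)\<bar> = real K * \<bar>of_int q * x - of_int y\<bar>"
      by (simp add: abs_mult)
    also have "\<dots> < real K * (1 / N)" using that by (intro mult_strict_left_mono) (auto simp: K_def)
    finally show ?thesis using small by simp
  qed
  have "int K * 1 \<le> int K * q" using q by (intro mult_left_mono) auto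
  moreover have "int M \<le> int K" by (simp add: K_def)
  ultimately have "int M \<le> int K * q" by linarith
  moreover have "\<bar>real_of_int (int K * q) * \<alpha> - real_of_int (int K * p 0)\<bar> < \<epsilon>"
    using p[of 0] by (intro scale) simp
  moreover have "\<bar>real_of_int (int K * q) * \<beta> - real_of_int (int K * p 1)\<bar> < \<epsilon>"
    using p[of 1] by (intro scale) simp
  ultimately show ?thesis by (rule that)
qed

text \<open>With \<open>v = sqrt 3 * u + x\<close> and \<open>w = sqrt 2 * u + y\<close> one has
  \<open>D = 2 * sqrt 3 * x * u + x\<^sup>2\<close> and \<open>F = 2 * D - 4 * sqrt 2 * y * u - 2 * y\<^sup>2\<close>, so for large \<open>u\<close> the
  inequalities of a row tower depend only on \<open>x\<close> and \<open>y\<close>. Around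
  \<open>(u, v, w) = (12, 21, 17)\<close>, where \<open>x\<close> is about 0.215 and \<open>y\<close> about 0.029, they hold with a margin
  for which the tolerance 0.004 is enough.\<close>

lemma tower_exists:
  obtains u v w :: nat and D F n where "M \<le> u" "row_tower u v w D F n"
proof -
  obtain q a b :: int where q: "int (M + 100) \<le> q"
    and a: "\<bar>q * sqrt 3 - a\<bar> < 4 / 1000" and b: "\<bar>q * sqrt 2 - b\<bar> < 4 / 1000"
    using simultaneous_approximation[where \<epsilon> = "4 / 1000" and \<alpha> = "sqrt 3" and \<beta> = "sqrt 2"
        and M = "M + 100"] by auto
  have s3: "17320 / 10000 < sqrt 3" "sqrt 3 < 17321 / 10000"
    by (rule real_less_rsqrt real_less_lsqrt; simp add: power2_eq_square)+
  have s2: "14142 / 10000 < sqrt 2" "sqrt 2 < 14143 / 10000"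
    by (rule real_less_rsqrt real_less_lsqrt; simp add: power2_eq_square)+
  \<comment> \<open>\<open>U\<close>, \<open>Z\<close>, \<open>W\<close> are \<open>u\<close>, \<open>v\<close>, \<open>w\<close> as integers.\<close>
  define U Z W where "U = q + 12" and "Z = a + 21" and "W = b + 17"
  define x y where "x = Z - sqrt 3 * U" and "y = W - sqrt 2 * U"
  have "x = 21 - 12 * sqrt 3 - (q * sqrt 3 - a)" by (simp add: x_def Z_def U_def algebra_simps)
  then have x: "21 / 100 < x" "x < 221 / 1000" using a s3 by linarith+
  have "y = 17 - 12 * sqrt 2 - (q * sqrt 2 - b)" by (simp add: y_def W_def U_def algebra_simps)
  then have y: "24 / 1000 < y" "y < 34 / 1000" using b s2 by linarith+
  have U: "112 \<le> real_of_int U" using q by (simp add: U_def)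
  define D n F where "D = Z ^ 2 - 3 * U ^ 2" and "n = Z ^ 2 - U ^ 2" and "F = 2 * n - 2 * W ^ 2"
  have "Z = sqrt 3 * U + x" by (simp add: x_def)
  then have D: "real_of_int D = 2 * (sqrt 3 * x * U) + x * x"
    by (simp add: D_def power2_eq_square algebra_simps)
  have "W = sqrt 2 * U + y" by (simp add: y_def)
  then have F: "real_of_int F = 2 * D - 4 * (sqrt 2 * y * U) - 2 * (y * y)"
    by (simp add: F_def n_def D_def power2_eq_square algebra_simps)
  have "(17320 / 10000) * (21 / 100) \<le> sqrt 3 * x" "sqrt 3 * x \<le> (17321 / 10000) * (221 / 1000)"
    using s3 x by (intro mult_mono; simp)+
  then have g: "(17320 / 10000) * (21 / 100) * U \<le> sqrt 3 * x * U"
    "sqrt 3 * x * U \<le> (17321 / 10000) * (221 / 1000) * U"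
    using U by (intro mult_right_mono; simp)+
  have "(14142 / 10000) * (24 / 1000) \<le> sqrt 2 * y" "sqrt 2 * y \<le> (14143 / 10000) * (34 / 1000)"
    using s2 y by (intro mult_mono; simp)+
  then have h: "(14142 / 10000) * (24 / 1000) * U \<le> sqrt 2 * y * U"
    "sqrt 2 * y * U \<le> (14143 / 10000) * (34 / 1000) * U"
    using U by (intro mult_right_mono; simp)+
  have "x * x \<le> 221 / 1000 * (221 / 1000)" "y * y \<le> 34 / 1000 * (34 / 1000)"
    using x y by (intro mult_mono; linarith)+
  then have sq: "0 \<le> x * x" "x * x \<le> 1 / 10" "0 \<le> y * y" "y * y \<le> 1 / 10" by simp_all
  have ZU: "(17320 / 10000) * U \<le> sqrt 3 * U" "sqrt 3 * U \<le> (17321 / 10000) * U"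
    and WU: "(14142 / 10000) * U \<le> sqrt 2 * U" "sqrt 2 * U \<le> (14143 / 10000) * U"
    using s3 s2 U by (intro mult_right_mono; simp)+
  have ineqs: "0 < real_of_int D" "real_of_int D \<le> U" "real_of_int F \<le> W" "real_of_int Z < D + F"
    "0 \<le> real_of_int Z" "0 \<le> real_of_int W"
    using D F g h sq ZU WU U x y \<open>Z = sqrt 3 * U + x\<close> \<open>W = sqrt 2 * U + y\<close> by linarith+
  then have "0 < D" "D \<le> U" "F \<le> W" "Z < D + F" "0 \<le> Z" "0 \<le> W" "0 \<le> U"
    using U by linarith+
  then have "row_tower (nat U) (nat Z) (nat W) D F n"
    by unfold_locales (auto simp: D_def n_def F_def)
  moreover have "M \<le> nat U" using q by (simp add: U_def)
  ultimately show ?thesis using that by blast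
qed

theorem proposition4p3:
  shows "infinite {\<omega>. periodic_word \<omega> \<and> symbolic_orbit \<omega>}"
proof
  let ?\<Omega> = "{\<omega>. periodic_word \<omega> \<and> symbolic_orbit \<omega>}"
  assume "finite ?\<Omega>"
  then have fin: "finite ((\<lambda>\<omega>. LEAST m. \<omega> m = A) ` ?\<Omega>)" by simp
  then obtain M where M: "\<And>k. k \<in> (\<lambda>\<omega>. LEAST m. \<omega> m = A) ` ?\<Omega> \<Longrightarrow> k < M"
    unfolding finite_nat_set_iff_bounded by blast
  obtain u v w D F n where "M \<le> u" "row_tower u v w D F n" using tower_exists by blast
  then interpret row_tower u v w D F n by simp
  have "symbolic_word broken hit_point \<in> ?\<Omega>"
    using row_tower_orbit word_periodic unfolding symbolic_orbit_def by blast
  then have "(LEAST m. symbolic_word broken hit_point m = A) < M" using M by blast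
  then show False using word_first_A \<open>M \<le> u\<close> by simp
qed

end
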